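(* For integers $n\ge3$, let $m=2^{n-1}+2^{n-3}$ and let $k$ be the diameter of the bipartite mixed graph $BDM(2,m)$. Then the number of vertices of $BDM(2,m)$ is of the order of $2^{k/2}\approx 1.4142^k$; that is, it is $\Theta(2^{k/2})$ as $n\to\infty$.
   Context: A mixed graph may contain undirected edges and directed edges (arcs). The distance from $u$ to $v$ is the length of a shortest path from $u$ to $v$, where edges may be traversed in both directions and arcs only along their orientation; the diameter is the maximum distance over all ordered pairs of vertices. For $m=2^{n-1}+2^{n-3}$, the mixed graph $BDM(2,m)$ has vertices $(\alpha,i)_\beta$ with $\alpha,\beta\in\{0,1\}$ and $i\in\mathbb{Z}_m$, with independent sets $V_\beta=\{(0,i)_\beta,(1,i)_\beta: i\in\mathbb{Z}_m\}$ for $\beta=0,1$. For every $i\in\mathbb{Z}_m$ (arithmetic modulo $m$) it has the edges $$(0,i)_0\sim(0,i)_1,\qquad (1,i)_0\sim(1,i)_1,$$ and the arcs $$(0,i)_0\to(1,2i)_1,\quad (0,i)_1\to(1,2i+1)_0,\quad (1,i)_0\to(0,-2i-1)_1,\quad (1,i)_1\to(0,-2i-2)_0 .$$ *)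

theory Defs
  imports Complex_Main "HOL-Library.Extended_Nat" "HOL-Library.Landau_Symbols"
begin

record 'v mixed_graph =
  verts :: "'v set"
  edges :: "'v set set"
  arcs :: "('v \<times> 'v) set"

definition mixed_graph :: "'v mixed_graph \<Rightarrow> bool" where
  "mixed_graph G \<longleftrightarrow>
     (\<forall>e\<in>edges G. e \<subseteq> verts G \<and> card e = 2) \<and>
     (\<forall>(u, v)\<in>arcs G. u \<in> verts G \<and> v \<in> verts G \<and> u \<noteq> v)"

definition independent_set :: "'v mixed_graph \<Rightarrow> 'v set \<Rightarrow> bool" where
  "independent_set G A \<longleftrightarrow>
     A \<subseteq> verts G \<and> (\<forall>u\<in>A. \<forall>v\<in>A. {u, v} \<notin> edges G \<and> (u, v) \<notin> arcs G)"

definition traversable :: "'v mixed_graph \<Rightarrow> 'v \<Rightarrow> 'v \<Rightarrow> bool" where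
  "traversable G u v \<longleftrightarrow> {u, v} \<in> edges G \<or> (u, v) \<in> arcs G"

text \<open>A path is given by its list of vertices, so its length is one less than that of the list.\<close>

definition is_path :: "'v mixed_graph \<Rightarrow> 'v \<Rightarrow> 'v list \<Rightarrow> 'v \<Rightarrow> bool" where
  "is_path G u p v \<longleftrightarrow>
     p \<noteq> [] \<and> hd p = u \<and> last p = v \<and> set p \<subseteq> verts G \<and> distinct p \<and>
     successively (traversable G) p"

text \<open>The distance is infinite if there is no path (infimum of the empty set).\<close>

definition mixed_distance :: "'v mixed_graph \<Rightarrow> 'v \<Rightarrow> 'v \<Rightarrow> enat" where
  "mixed_distance G u v = (INF p\<in>{p. is_path G u p v}. enat (length p - 1))"

definition mixed_diameter :: "'v mixed_graph \<Rightarrow> enat" where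
  "mixed_diameter G = (SUP (u, v)\<in>verts G \<times> verts G. mixed_distance G u v)"

text \<open>The triple \<open>(\<alpha>, i, \<beta>)\<close> stands for the vertex \<open>(\<alpha>, i)\<^sub>\<beta>\<close>; elements of
  \<open>\<int>\<^sub>m\<close> are represented by their residues in \<open>{0..<m}\<close>.\<close>

type_synonym bdm_vertex = "nat \<times> int \<times> nat"

definition BDM2_part :: "nat \<Rightarrow> nat \<Rightarrow> bdm_vertex set" where
  "BDM2_part m \<beta> = {(\<alpha>, i, \<beta>) | \<alpha> i. \<alpha> \<in> {0, 1} \<and> i \<in> {0..<int m}}"

definition BDM2 :: "nat \<Rightarrow> bdm_vertex mixed_graph" where
  "BDM2 m = \<lparr>
     verts = BDM2_part m 0 \<union> BDM2_part m 1,
     edges = (\<Union>i\<in>{0..<int m}. {{(0, i, 0), (0, i, 1)}, {(1, i, 0), (1, i, 1)}}),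
     arcs = (\<Union>i\<in>{0..<int m}.
       {((0, i, 0), (1, (2 * i) mod int m, 1)),
        ((0, i, 1), (1, (2 * i + 1) mod int m, 0)),
        ((1, i, 0), (0, (- 2 * i - 1) mod int m, 1)),
        ((1, i, 1), (0, (- 2 * i - 2) mod int m, 0))})\<rparr>"

definition BDM_modulus :: "nat \<Rightarrow> nat" where
  "BDM_modulus n = 2 ^ (n - 1) + 2 ^ (n - 3)"

lemma mixed_graph_BDM2: "mixed_graph (BDM2 m)"
  by (auto simp: mixed_graph_def BDM2_def BDM2_part_def)

lemma independent_BDM2_part:
  assumes "\<beta> \<in> {0, 1}"
  shows "independent_set (BDM2 m) (BDM2_part m \<beta>)"
  using assms by (auto simp: independent_set_def BDM2_def BDM2_part_def doubleton_eq_iff)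

end

theory Submission
  imports Defs "HOL-Number_Theory.Cong"
begin

text \<open>Along the arcs, the index of a vertex \<open>(\<alpha>, i)\<^sub>\<beta>\<close> is doubled and shifted by \<open>\<beta>\<close>, up to a sign
  and a shift depending on \<open>\<alpha>\<close> only. Choosing \<open>\<beta>\<close> freely before each arc (at the price of at most one
  edge), one reaches by \<open>t\<close> arcs the residues of \<open>2\<^sup>t\<close> consecutive integers, so the diameter is at
  most \<open>2n + 3\<close>.

  Conversely, put \<open>D = 5i + 1 + \<alpha>\<close>. Then an arc maps \<open>D\<close> to \<open>\<plusminus>(2D + 5\<beta>)\<close> and changes \<open>\<beta>\<close> into \<open>1 - \<beta>\<close>.
  Hence \<open>D\<close> becomes odd after an arc from \<open>V\<^sub>1\<close>, and its \<open>2\<close>-adic valuation grows by one on an arc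
  from \<open>V\<^sub>0\<close>, so that twice the valuation minus \<open>\<beta>\<close> increases by at most one in each step. A vertex with
  \<open>2\<^sup>n\<^sup>-\<^sup>3\<close> dividing \<open>D\<close> is thus at distance at least \<open>2(n - 3)\<close> from \<open>(0, 0)\<^sub>0\<close>. As there are
  \<open>5 \<cdot> 2\<^sup>n\<^sup>-\<^sup>1\<close> vertices, both bounds together give the claim.\<close>

section \<open>Walks, distances and the diameter\<close>

definition walk_step :: "'v mixed_graph \<Rightarrow> ('v \<times> 'v) set" where
  "walk_step G = {(u, v). u \<in> verts G \<and> v \<in> verts G \<and> traversable G u v}"

lemma walk_of_path:
  assumes "is_path G u p v"
  shows "(u, v) \<in> walk_step G ^^ (length p - 1)"
  using assms
proof (induction p arbitrary: u)
  case Nil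
  then show ?case by (simp add: is_path_def)
next
  case (Cons x q)
  show ?case
  proof (cases q)
    case Nil
    with Cons.prems show ?thesis by (auto simp: is_path_def)
  next
    case (Cons y q')
    have "is_path G y q v" and "(u, y) \<in> walk_step G"
      using Cons.prems Cons by (auto simp: is_path_def walk_step_def)
    then have "(u, v) \<in> walk_step G ^^ Suc (length q - 1)"
      using Cons.IH by (blast intro: relpow_Suc_I2)
    then show ?thesis using Cons by simp
  qed
qed

text \<open>A walk may repeat vertices and a path may not: if the next vertex already lies on the
  path, the path is cut there; otherwise it is extended.\<close>

lemma path_of_walk:
  assumes "(u, v) \<in> walk_step G ^^ k" "u \<in> verts G"
  shows "\<exists>p. is_path G u p v \<and> length p - 1 \<le> k"
  using assms
proof (induction k arbitrary: v)
  case 0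
  then have "is_path G u [u] v" by (simp add: is_path_def)
  then show ?case by (intro exI[of _ "[u]"]) simp
next
  case (Suc k)
  then obtain w where "(u, w) \<in> walk_step G ^^ k" and wv: "(w, v) \<in> walk_step G" by auto
  then obtain p where p: "is_path G u p w" "length p - 1 \<le> k" using Suc by blast
  show ?case
  proof (cases "v \<in> set p")
    case True
    then obtain xs ys where p_eq: "p = (xs @ [v]) @ ys"
      by (metis append_Cons append_Nil append_assoc split_list)
    have "successively (traversable G) (xs @ [v])"
      using p(1) unfolding is_path_def p_eq successively_append_iff[of _ "xs @ [v]"] by blast
    then have "is_path G u (xs @ [v]) v"
      using p(1) unfolding is_path_def p_eq by (cases xs) auto
    moreover have "length (xs @ [v]) - 1 \<le> Suc k" using p(2) p_eq by simp
    ultimately show ?thesis by blast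
  next
    case False
    have "is_path G u (p @ [v]) v"
      using p(1) wv False by (auto simp: is_path_def walk_step_def successively_append_iff)
    moreover have "length (p @ [v]) - 1 \<le> Suc k" using p(2) by simp
    ultimately show ?thesis by blast
  qed
qed

lemma mixed_distance_le:
  assumes "(u, v) \<in> walk_step G ^^ k" "u \<in> verts G"
  shows "mixed_distance G u v \<le> enat k"
proof -
  obtain p where "is_path G u p v" "length p - 1 \<le> k" using path_of_walk[OF assms] by blast
  then show ?thesis unfolding mixed_distance_def by (intro INF_lower2[of p]) auto
qed

lemma mixed_diameter_le:
  assumes "\<And>u v. u \<in> verts G \<Longrightarrow> v \<in> verts G \<Longrightarrow> \<exists>l\<le>k. (u, v) \<in> walk_step G ^^ l"
  shows "mixed_diameter G \<le> enat k"
  unfolding mixed_diameter_def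
proof (intro SUP_least, clarify)
  fix u v assume "u \<in> verts G" "v \<in> verts G"
  moreover from assms[OF this] obtain l where "l \<le> k" "(u, v) \<in> walk_step G ^^ l" by blast
  ultimately show "mixed_distance G u v \<le> enat k"
    using mixed_distance_le[of u v l G] by (metis enat_ord_simps(1) order_trans)
qed

text \<open>A bound on all walks suffices, as every path is a walk; walks suit induction
  better.\<close>

lemma mixed_diameter_ge:
  assumes "u \<in> verts G" "v \<in> verts G" "\<And>l. (u, v) \<in> walk_step G ^^ l \<Longrightarrow> k \<le> l"
  shows "enat k \<le> mixed_diameter G"
proof -
  have "enat k \<le> mixed_distance G u v"
    unfolding mixed_distance_def using assms(3) walk_of_path by (intro INF_greatest) fastforce
  also have "\<dots> \<le> mixed_diameter G"
    unfolding mixed_diameter_def using assms(1,2) by (intro SUP_upper2[of "(u, v)"]) auto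
  finally show ?thesis .
qed

section \<open>The upper bound on the diameter\<close>

lemma mem_verts_BDM2:
  "(\<alpha>, i, \<beta>) \<in> verts (BDM2 m) \<longleftrightarrow> \<alpha> \<in> {0, 1} \<and> i \<in> {0..<int m} \<and> \<beta> \<in> {0, 1}"
  by (auto simp: BDM2_def BDM2_part_def)

lemma card_verts_BDM2: "card (verts (BDM2 m)) = 4 * m"
proof -
  have "verts (BDM2 m) = {0, 1} \<times> {0..<int m} \<times> {0, 1}"
    by (auto simp: BDM2_def BDM2_part_def)
  then show ?thesis by (simp add: card_cartesian_product)
qed

lemma BDM2_edge_step:
  assumes "\<alpha> \<in> {0, 1}" "i \<in> {0..<int m}" "\<beta> \<in> {0, 1}"
  shows "((\<alpha>, i, \<beta>), (\<alpha>, i, 1 - \<beta>)) \<in> walk_step (BDM2 m)"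
  using assms unfolding walk_step_def traversable_def
  by (auto simp: BDM2_def BDM2_part_def doubleton_eq_iff)

text \<open>Not reduced modulo \<open>m\<close>, so that intervals of integers can be followed along
  arcs.\<close>

definition arc_index :: "nat \<Rightarrow> int \<Rightarrow> nat \<Rightarrow> int" where
  "arc_index \<alpha> x \<beta> = (if \<alpha> = 0 then 2 * x + int \<beta> else - 2 * x - (1 + int \<beta>))"

lemma arc_index_mod: "arc_index \<alpha> (x mod k) \<beta> mod k = arc_index \<alpha> x \<beta> mod k"
proof -
  have "[arc_index \<alpha> (x mod k) \<beta> = arc_index \<alpha> x \<beta>] (mod k)"
    by (auto simp: arc_index_def intro!: cong_add cong_diff cong_mult
        simp: cong_minus_minus_iff)
  then show ?thesis by (simp add: cong_def)
qed

lemma BDM2_arc_iff: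
  "((\<alpha>, i, \<beta>), (\<alpha>', j, \<beta>')) \<in> arcs (BDM2 m) \<longleftrightarrow>
    \<alpha> \<in> {0, 1} \<and> i \<in> {0..<int m} \<and> \<beta> \<in> {0, 1} \<and>
    \<alpha>' = 1 - \<alpha> \<and> j = arc_index \<alpha> i \<beta> mod int m \<and> \<beta>' = 1 - \<beta>"
  by (auto simp: BDM2_def arc_index_def)

lemma BDM2_arc_step:
  assumes "\<alpha> \<in> {0, 1}" "\<beta> \<in> {0, 1}" "m > 0"
  shows "((\<alpha>, x mod int m, \<beta>), (1 - \<alpha>, arc_index \<alpha> x \<beta> mod int m, 1 - \<beta>)) \<in> walk_step (BDM2 m)"
  using assms unfolding walk_step_def traversable_def
  by (auto simp: mem_verts_BDM2 BDM2_arc_iff arc_index_mod)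

text \<open>An edge flips \<beta> and keeps the index, so at most one edge gives free choice of the
  bit \<open>b\<close> used by the arc.\<close>

lemma BDM2_two_steps:
  assumes "\<alpha> \<in> {0, 1}" "\<beta> \<in> {0, 1}" "b \<in> {0, 1}" "m > 0"
  shows "\<exists>l\<le>2. ((\<alpha>, x mod int m, \<beta>), (1 - \<alpha>, arc_index \<alpha> x b mod int m, 1 - b))
    \<in> walk_step (BDM2 m) ^^ l"
proof (cases "\<beta> = b")
  case True
  then show ?thesis using BDM2_arc_step[of \<alpha> b m x] assms by (intro exI[of _ 1]) auto
next
  case False
  then have "((\<alpha>, x mod int m, \<beta>), (\<alpha>, x mod int m, b)) \<in> walk_step (BDM2 m)"
    using BDM2_edge_step[of \<alpha> "x mod int m" m \<beta>] assms by auto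
  then show ?thesis using BDM2_arc_step[of \<alpha> b m x] assms
    by (intro exI[of _ 2]) (auto simp: numeral_2_eq_2)
qed

text \<open>The bit \<open>b\<close> fills the gaps left by doubling: \<open>x\<close> and
  \<open>b\<close> are quotient and remainder by 2 of \<open>y\<close>, or of \<open>- 1 - y\<close>
  when the map reverses order. In the latter case the image starts at
  \<open>- 2 * a - 2 * L\<close>.\<close>

lemma arc_index_interval:
  "\<exists>c. \<forall>y\<in>{c..<c + 2 * L}. \<exists>x\<in>{a..<a + L}. \<exists>b\<in>{0, 1}. y = arc_index \<alpha> x b"
proof (cases "\<alpha> = 0")
  case True
  have "\<exists>x\<in>{a..<a + L}. \<exists>b\<in>{0, 1}. y = arc_index \<alpha> x b"
    if "y \<in> {2 * a..<2 * a + 2 * L}" for y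
  proof (intro bexI)
    show "y = arc_index \<alpha> (y div 2) (nat (y mod 2))" using True by (simp add: arc_index_def)
    show "nat (y mod 2) \<in> {0, 1}" by (cases "even y") (auto simp: mod_2_eq_odd)
  qed (use that in auto)
  then show ?thesis by blast
next
  case False
  have "\<exists>x\<in>{a..<a + L}. \<exists>b\<in>{0, 1}. y = arc_index \<alpha> x b"
    if "y \<in> {- 2 * a - 2 * L..<- 2 * a - 2 * L + 2 * L}" for y
  proof (intro bexI)
    show "y = arc_index \<alpha> ((- 1 - y) div 2) (nat ((- 1 - y) mod 2))"
      using False mult_div_mod_eq[of 2 "- 1 - y"] unfolding arc_index_def by simp presburger
    show "nat ((- 1 - y) mod 2) \<in> {0, 1}" by (cases "even y") (auto simp: mod_2_eq_odd)
  qed (use that in auto)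
  then show ?thesis by blast
qed

text \<open>Each further arc costs at most two steps and doubles the interval.\<close>

lemma BDM2_walks_to_interval:
  assumes "\<alpha> \<in> {0, 1}" "i \<in> {0..<int m}" "\<beta> \<in> {0, 1}"
  shows "\<exists>a. \<forall>x\<in>{a..<a + 2 ^ t}. \<exists>\<beta>'\<in>{0, 1}. \<exists>l\<le>2 * t.
    ((\<alpha>, i, \<beta>), ((\<alpha> + t) mod 2, x mod int m, \<beta>')) \<in> walk_step (BDM2 m) ^^ l"
proof (induction t)
  case 0
  show ?case using assms by (intro exI[of _ i]) auto
next
  case (Suc t)
  define \<gamma> where "\<gamma> = (\<alpha> + t) mod 2"
  have \<gamma>: "\<gamma> \<in> {0, 1}" "(\<alpha> + Suc t) mod 2 = 1 - \<gamma>"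
    unfolding \<gamma>_def by (auto, presburger+)
  have "m > 0" using assms(2) by auto
  obtain a where a: "\<forall>x\<in>{a..<a + 2 ^ t}. \<exists>\<beta>'\<in>{0, 1}. \<exists>l\<le>2 * t.
      ((\<alpha>, i, \<beta>), (\<gamma>, x mod int m, \<beta>')) \<in> walk_step (BDM2 m) ^^ l"
    using Suc unfolding \<gamma>_def by blast
  obtain c where c: "\<forall>y\<in>{c..<c + 2 * 2 ^ t}. \<exists>x\<in>{a..<a + 2 ^ t}. \<exists>b\<in>{0, 1}. y = arc_index \<gamma> x b"
    using arc_index_interval by blast
  have "\<exists>\<beta>'\<in>{0, 1}. \<exists>l\<le>2 * Suc t.
      ((\<alpha>, i, \<beta>), (1 - \<gamma>, y mod int m, \<beta>')) \<in> walk_step (BDM2 m) ^^ l"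
    if y: "y \<in> {c..<c + 2 ^ Suc t}" for y
  proof -
    obtain x b where x: "x \<in> {a..<a + 2 ^ t}" "b \<in> {0, 1}" "y = arc_index \<gamma> x b"
      using bspec[OF c y[unfolded power_Suc]] by blast
    obtain \<beta>' l where l: "\<beta>' \<in> {0, 1}" "l \<le> 2 * t"
      "((\<alpha>, i, \<beta>), (\<gamma>, x mod int m, \<beta>')) \<in> walk_step (BDM2 m) ^^ l"
      using a x(1) by blast
    obtain l' where l': "l' \<le> 2"
      "((\<gamma>, x mod int m, \<beta>'), (1 - \<gamma>, y mod int m, 1 - b)) \<in> walk_step (BDM2 m) ^^ l'"
      using BDM2_two_steps[OF \<gamma>(1) l(1) x(2) \<open>m > 0\<close>] x(3) by blast
    have "((\<alpha>, i, \<beta>), (1 - \<gamma>, y mod int m, 1 - b)) \<in> walk_step (BDM2 m) ^^ (l + l')"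
      using l(3) l'(2) by (auto simp: relpow_add)
    moreover have "l + l' \<le> 2 * Suc t" "1 - b \<in> {0, 1}" using l(2) l'(1) x(2) by auto
    ultimately show ?thesis by blast
  qed
  then show ?case unfolding \<gamma>(2) by blast
qed

lemma residue_in_interval:
  fixes a j k L :: int
  assumes "j \<in> {0..<k}" "k \<le> L"
  shows "\<exists>x\<in>{a..<a + L}. x mod k = j"
proof
  show "(a + (j - a) mod k) mod k = j" using assms by (simp add: mod_add_right_eq)
  have "k > 0" using assms(1) by auto
  then have "0 \<le> (j - a) mod k" "(j - a) mod k < k" by simp_all
  then show "a + (j - a) mod k \<in> {a..<a + L}" using assms(2) by (simp del: pos_mod_bound)
qed

lemma mixed_diameter_BDM2_le:
  assumes "m \<le> 2 ^ n"
  shows "mixed_diameter (BDM2 m) \<le> enat (2 * n + 3)"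
proof (intro mixed_diameter_le)
  fix u v assume uv: "u \<in> verts (BDM2 m)" "v \<in> verts (BDM2 m)"
  obtain \<alpha> i \<beta> where u: "u = (\<alpha>, i, \<beta>)" "\<alpha> \<in> {0, 1}" "i \<in> {0..<int m}" "\<beta> \<in> {0, 1}"
    using uv(1) by (metis mem_verts_BDM2 prod_cases3)
  obtain \<alpha>' j \<beta>' where v: "v = (\<alpha>', j, \<beta>')" "\<alpha>' \<in> {0, 1}" "j \<in> {0..<int m}" "\<beta>' \<in> {0, 1}"
    using uv(2) by (metis mem_verts_BDM2 prod_cases3)
  \<comment> \<open>Every arc switches \<alpha>, so the parity of the number of arcs is forced. A
    last edge may correct \<beta>, whence the bound \<open>2 * (n + 1) + 1\<close>.\<close>
  have "(\<alpha> + n) mod 2 = \<alpha>' \<or> (\<alpha> + (n + 1)) mod 2 = \<alpha>'"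
    using u(2) v(2) by auto presburger+
  then obtain t where t: "n \<le> t" "t \<le> n + 1" "(\<alpha> + t) mod 2 = \<alpha>'"
    by (elim disjE) (use le_add1 in blast)+
  obtain a where a: "\<forall>x\<in>{a..<a + 2 ^ t}. \<exists>\<beta>'\<in>{0, 1}. \<exists>l\<le>2 * t.
      (u, (\<alpha>', x mod int m, \<beta>')) \<in> walk_step (BDM2 m) ^^ l"
    using BDM2_walks_to_interval[OF u(2-4), of t] t(3) u(1) by blast
  have "m \<le> 2 ^ t" using assms power_increasing[OF t(1), of "2::nat"] by linarith
  then have "int m \<le> 2 ^ t" using of_nat_mono[of m "2 ^ t", where 'a = int] by simp
  then obtain x where "x \<in> {a..<a + 2 ^ t}" "x mod int m = j"
    using residue_in_interval[OF v(3)] by blast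
  then obtain \<gamma> l where l: "\<gamma> \<in> {0, 1}" "l \<le> 2 * t"
    "(u, (\<alpha>', j, \<gamma>)) \<in> walk_step (BDM2 m) ^^ l"
    using a by blast
  show "\<exists>l\<le>2 * n + 3. (u, v) \<in> walk_step (BDM2 m) ^^ l"
  proof (cases "\<gamma> = \<beta>'")
    case True
    then show ?thesis using l t(2) v(1) by (intro exI[of _ l]) auto
  next
    case False
    then have "((\<alpha>', j, \<gamma>), v) \<in> walk_step (BDM2 m)"
      using BDM2_edge_step[OF v(2,3) l(1)] v l(1) by auto
    then show ?thesis using l t(2) by (intro exI[of _ "Suc l"]) auto
  qed
qed

section \<open>The lower bound on the diameter\<close>

text \<open>For \<beta> = 0 the two index maps compose to \<open>- 4 * i - 1\<close> or
  \<open>- 4 * i - 2\<close>, with fixed points -1/5 and -2/5. This is 5 times the offset of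
  \<open>i\<close> from the fixed point belonging to \<alpha>.\<close>

definition shifted_index :: "nat \<Rightarrow> int \<Rightarrow> int" where
  "shifted_index \<alpha> i = 5 * i + 1 + int \<alpha>"

text \<open>Divisibility by a divisor of the modulus is blind to the reduction and to the
  sign.\<close>

lemma dvd_shifted_arc_index:
  assumes "d dvd k" "\<alpha> \<in> {0, 1}"
  shows "d dvd shifted_index (1 - \<alpha>) (arc_index \<alpha> i \<beta> mod k) \<longleftrightarrow>
    d dvd 2 * shifted_index \<alpha> i + 5 * int \<beta>"
proof -
  have "[arc_index \<alpha> i \<beta> mod k = arc_index \<alpha> i \<beta>] (mod d)"
    using assms(1) cong_dvd_modulus cong_mod_left cong_refl by blast
  then have "[shifted_index (1 - \<alpha>) (arc_index \<alpha> i \<beta> mod k)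
      = shifted_index (1 - \<alpha>) (arc_index \<alpha> i \<beta>)] (mod d)"
    unfolding shifted_index_def by (intro cong_add cong_mult) auto
  then have "d dvd shifted_index (1 - \<alpha>) (arc_index \<alpha> i \<beta> mod k) \<longleftrightarrow>
      d dvd shifted_index (1 - \<alpha>) (arc_index \<alpha> i \<beta>)"
    by (rule cong_dvd_iff)
  moreover have "shifted_index (1 - \<alpha>) (arc_index \<alpha> i \<beta>) = 2 * shifted_index \<alpha> i + 5 * int \<beta> \<or>
      shifted_index (1 - \<alpha>) (arc_index \<alpha> i \<beta>) = - (2 * shifted_index \<alpha> i + 5 * int \<beta>)"
    using assms(2) by (auto simp: shifted_index_def arc_index_def)
  ultimately show ?thesis by (metis dvd_minus_iff)
qed

lemma BDM2_traversable_cases: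
  assumes "traversable (BDM2 m) (\<alpha>, i, \<beta>) (\<alpha>', j, \<beta>')"
  shows "\<alpha>' = \<alpha> \<and> j = i \<and> \<beta> \<in> {0, 1} \<or> ((\<alpha>, i, \<beta>), (\<alpha>', j, \<beta>')) \<in> arcs (BDM2 m)"
  using assms unfolding traversable_def by (auto simp: BDM2_def doubleton_eq_iff)

text \<open>In terms of the \<open>2\<close>-adic valuation of \<open>shifted_index \<alpha> i\<close>, capped at \<open>N\<close>: twice the valuation
  minus \<open>\<beta>\<close> is at most the length \<open>l\<close> of the walk.\<close>

lemma walk_valuation_le:
  assumes "2 ^ N dvd int m" "((0, 0, 0), (\<alpha>, i, \<beta>)) \<in> walk_step (BDM2 m) ^^ l"
    and "a \<le> N" "2 ^ a dvd shifted_index \<alpha> i"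
  shows "2 * a \<le> l + \<beta>"
  using assms(2-4)
proof (induction l arbitrary: \<alpha> i \<beta> a)
  case 0
  then have "(2::int) ^ a = 1" by (simp add: shifted_index_def)
  then have "a = 0" by simp
  then show ?case by simp
next
  case (Suc l)
  then obtain \<gamma> j \<delta> where w: "((0, 0, 0), (\<gamma>, j, \<delta>)) \<in> walk_step (BDM2 m) ^^ l"
    and step: "((\<gamma>, j, \<delta>), (\<alpha>, i, \<beta>)) \<in> walk_step (BDM2 m)"
    by (metis prod_cases3 relpow_Suc_E)
  from step have "traversable (BDM2 m) (\<gamma>, j, \<delta>) (\<alpha>, i, \<beta>)" by (simp add: walk_step_def)
  then consider "\<alpha> = \<gamma>" "i = j" "\<delta> \<in> {0, 1}" | "((\<gamma>, j, \<delta>), (\<alpha>, i, \<beta>)) \<in> arcs (BDM2 m)"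
    using BDM2_traversable_cases by blast
  then show ?case
  proof cases
    case 1
    \<comment> \<open>An edge lowers \<beta> by at most one, which the extra step pays for.\<close>
    then show ?thesis using Suc.IH[OF w Suc.prems(2)] Suc.prems(3) by auto
  next
    case 2
    then have arc: "\<gamma> \<in> {0, 1}" "\<delta> \<in> {0, 1}" "\<alpha> = 1 - \<gamma>" "i = arc_index \<gamma> j \<delta> mod int m"
      "\<beta> = 1 - \<delta>"
      by (auto simp: BDM2_arc_iff)
    have "(2::int) ^ a dvd int m"
      using assms(1) le_imp_power_dvd[OF Suc.prems(2)] dvd_trans by blast
    then have dvd: "2 ^ a dvd 2 * shifted_index \<gamma> j + 5 * int \<delta>"
      using Suc.prems(3) dvd_shifted_arc_index[OF _ arc(1)] arc(3,4) by blast
    show ?thesis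
    proof (cases a)
      case (Suc a')
      \<comment> \<open>Evenness forces the arc to start in part 0 and hence to end with \<beta> =
        1. One factor 2 is cancelled, and the gain of 2 on the left is matched by the step and by
        \<beta>.\<close>
      then have "even (2 * shifted_index \<gamma> j + 5 * int \<delta>)"
        using dvd dvd_mult_left by fastforce
      then have "\<delta> = 0" using arc(2) by auto
      then have "2 ^ a' dvd shifted_index \<gamma> j" using dvd Suc by simp
      then have "2 * a' \<le> l" using Suc.IH[OF w] Suc Suc.prems(2) \<open>\<delta> = 0\<close> by fastforce
      then show ?thesis using Suc arc(5) \<open>\<delta> = 0\<close> by simp
    qed simp
  qed
qed

lemma mixed_diameter_BDM2_ge:
  assumes "2 ^ N dvd int m" "m > 0"
  shows "enat (2 * N) \<le> mixed_diameter (BDM2 m)"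
proof -
  \<comment> \<open>The target index is -1/5 modulo \<open>2 ^ N\<close>, so its shifted index is
    divisible by \<open>2 ^ N\<close>.\<close>
  have "coprime (5::int) (2 ^ N)" by (simp add: coprime_commute)
  then obtain z :: int where "[5 * z = - 1] (mod 2 ^ N)"
    using cong_solve_coprime_int[of 5 "2 ^ N"] cong_scalar_left[of _ _ "2 ^ N" "- 1"]
    by (metis mult.left_commute mult_minus1 mult.right_neutral)
  then have "2 ^ N dvd 5 * z + 1" by (simp add: cong_iff_dvd_diff)
  moreover have "[z mod int m = z] (mod 2 ^ N)"
    using assms(1) cong_dvd_modulus cong_mod_left cong_refl by blast
  then have "[5 * (z mod int m) + 1 = 5 * z + 1] (mod 2 ^ N)"
    by (intro cong_add cong_mult) auto
  ultimately have "2 ^ N dvd shifted_index 0 (z mod int m)"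
    using cong_dvd_iff unfolding shifted_index_def by fastforce
  then have "2 * N \<le> l" if "((0, 0, 0), (0, z mod int m, 0)) \<in> walk_step (BDM2 m) ^^ l" for l
    using walk_valuation_le[OF assms(1) that, of N] by simp
  then show ?thesis
    using assms(2) by (intro mixed_diameter_ge[of "(0, 0, 0)" _ "(0, z mod int m, 0)"])
      (auto simp: mem_verts_BDM2)
qed

section \<open>The moduli of the family and the order of growth\<close>

lemma BDM_modulus_eq:
  assumes "n \<ge> 3"
  shows "BDM_modulus n = 5 * 2 ^ (n - 3)"
proof -
  have "n - 1 = (n - 3) + 2" using assms by simp
  then have "(2::nat) ^ (n - 1) = 4 * 2 ^ (n - 3)" by (simp only: power_add) simp
  then show ?thesis by (simp add: BDM_modulus_def)
qed

text \<open>The lower bound applies with \<open>N = n - 3\<close>, the upper one since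
  \<open>5 * 2 ^ (n - 3) \<le> 8 * 2 ^ (n - 3) = 2 ^ n\<close>.\<close>

lemma mixed_diameter_BDM_modulus:
  assumes "n \<ge> 3"
  obtains k where "mixed_diameter (BDM2 (BDM_modulus n)) = enat k" "2 * (n - 3) \<le> k" "k \<le> 2 * n + 3"
proof -
  have "n = (n - 3) + 3" using assms by simp
  then have "(2::nat) ^ n = 8 * 2 ^ (n - 3)" by (metis mult.commute power_add power3_eq_cube
        mult_2 numeral_Bit0 one_add_one)
  then have "mixed_diameter (BDM2 (BDM_modulus n)) \<le> enat (2 * n + 3)"
    by (intro mixed_diameter_BDM2_le) (simp add: BDM_modulus_eq[OF assms])
  moreover have "enat (2 * (n - 3)) \<le> mixed_diameter (BDM2 (BDM_modulus n))"
    by (intro mixed_diameter_BDM2_ge) (simp_all add: BDM_modulus_eq[OF assms])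
  ultimately show thesis 
    by (cases "mixed_diameter (BDM2 (BDM_modulus n))") (auto intro: that)
qed

text \<open>Finiteness is included because \<open>the_enat\<close> is meaningful only at finite
  values.\<close>

theorem corollary3p3:
  shows "(\<forall>n\<ge>3. mixed_diameter (BDM2 (BDM_modulus n)) \<noteq> \<infinity>) \<and>
    (\<lambda>n. real (card (verts (BDM2 (BDM_modulus n)))))
      \<in> \<Theta>[at_top](\<lambda>n. 2 powr (real (the_enat (mixed_diameter (BDM2 (BDM_modulus n)))) / 2))"
proof (intro conjI allI impI)
  fix n :: nat assume "n \<ge> 3"
  then show "mixed_diameter (BDM2 (BDM_modulus n)) \<noteq> \<infinity>"
    using mixed_diameter_BDM_modulus by (metis enat.distinct(1))
next
  let ?V = "\<lambda>n. real (card (verts (BDM2 (BDM_modulus n))))"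
  let ?P = "\<lambda>n. 2 powr (real (the_enat (mixed_diameter (BDM2 (BDM_modulus n)))) / 2)"
  \<comment> \<open>With \<open>q = 2 ^ (n - 3)\<close>, the order is \<open>20 * q\<close>, while
    \<open>?P n\<close> lies between \<open>q\<close> and \<open>32 * q\<close>, as
    \<open>k / 2 \<le> (n - 3) + 9 / 2\<close>.\<close>
  have bounds: "?V n \<le> 20 * ?P n \<and> ?P n \<le> 2 * ?V n" if n: "n \<ge> 3" for n
  proof -
    obtain k where k: "mixed_diameter (BDM2 (BDM_modulus n)) = enat k" "2 * (n - 3) \<le> k" "k \<le> 2 * n + 3"
      by (rule mixed_diameter_BDM_modulus[OF n])
    have V: "?V n = 20 * 2 powr real (n - 3)"
      by (simp add: card_verts_BDM2 BDM_modulus_eq[OF n] powr_realpow)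
    have "2 powr real (n - 3) \<le> (2::real) powr (real k / 2)"
      using k(2) by (intro powr_mono) linarith+
    moreover have "(2::real) powr (real k / 2) \<le> 2 powr (real (n - 3) + 5)"
      using k(3) n by (intro powr_mono) (simp_all add: of_nat_diff)
    moreover have "(2::real) powr (real (n - 3) + 5) = 32 * 2 powr real (n - 3)"
      by (simp add: powr_add)
    moreover have "(0::real) < 2 powr real (n - 3)" by simp
    ultimately show ?thesis unfolding V k(1) the_enat.simps by linarith
  qed
  show "?V \<in> \<Theta>[at_top](?P)"
  proof (rule bigthetaI)
    show "?V \<in> O(?P)"
      using eventually_ge_at_top[of 3]
      by (intro bigoI[of _ 20], eventually_elim) (use bounds in auto)
    show "?V \<in> \<Omega>(?P)"
      unfolding bigomega_iff_bigo using eventually_ge_at_top[of 3]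
      by (intro bigoI[of _ 2], eventually_elim) (use bounds in auto)
  qed
qed

end
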